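(* Let $p>1$ and let $\varphi:\mathcal{W}_p([0,1])\to\mathcal{W}_p([0,1])$ be an isometric embedding, that is, $d_{\mathcal{W}_p}(\varphi(\mu),\varphi(\nu))=d_{\mathcal{W}_p}(\mu,\nu)$ for all $\mu,\nu\in\mathcal{W}_p([0,1])$ (surjectivity is not assumed). Then either $\varphi=\mathrm{id}_{\mathcal{W}_p([0,1])}$ or $\varphi=r_\#$. Consequently, every isometric embedding is surjective, and $\mathrm{IsEmb}(\mathcal{W}_p([0,1]))=\mathrm{Isom}(\mathcal{W}_p([0,1]))$ is (isomorphic to) the two-element group $C_2$.
   Context: $\mathcal{W}_p([0,1])$ is the set of all Borel probability measures on $[0,1]$ with the $p$-Wasserstein distance $d_{\mathcal{W}_p}(\mu,\nu)=\left(\inf_{\pi}\int |x-y|^p\,d\pi(x,y)\right)^{1/p}$, the infimum being over all couplings $\pi$ of $\mu$ and $\nu$. An isometric embedding of a metric space is a distance preserving self-map; an isometry is a surjective isometric embedding; $\mathrm{IsEmb}$ and $\mathrm{Isom}$ denote the semigroup of isometric embeddings and the group of isometries. The map $r_\#$ is the push-forward induced by $r:[0,1]\to[0,1]$, $r(x)=1-x$, i.e. $(r_\#\mu)(A)=\mu(r^{-1}[A])$ for Borel $A\subseteq[0,1]$. *)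

theory Defs
  imports
    "HOL-Probability.Probability"
    "HOL-Algebra.Elementary_Groups"
begin

definition unit_borel :: "real measure" where
  "unit_borel = restrict_space borel {0..1}"

(* The underlying set does not depend on p: all moments are finite on [0,1]. *)
definition wspace :: "real measure set" where
  "wspace = {\<mu>. prob_space \<mu> \<and> sets \<mu> = sets unit_borel}"

definition couplings :: "real measure \<Rightarrow> real measure \<Rightarrow> (real \<times> real) measure set" where
  "couplings \<mu> \<nu> =
    {\<pi>. prob_space \<pi> \<and> sets \<pi> = sets (unit_borel \<Otimes>\<^sub>M unit_borel) \<and>
        distr \<pi> unit_borel fst = \<mu> \<and> distr \<pi> unit_borel snd = \<nu>}"

(* For \<mu>, \<nu> in wspace the infimum is over a nonempty set (the product measure is a coupling)
   of reals in [0,1], and every integrand is bounded and measurable, so neither the real-valued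
   infimum nor the Bochner integral falls back on a default value. *)
definition wdist :: "real \<Rightarrow> real measure \<Rightarrow> real measure \<Rightarrow> real" where
  "wdist p \<mu> \<nu> =
    (INF \<pi>\<in>couplings \<mu> \<nu>. \<integral>(x, y). \<bar>x - y\<bar> powr p \<partial>\<pi>) powr (1 / p)"

definition reflection_push :: "real measure \<Rightarrow> real measure" where
  "reflection_push \<mu> = distr \<mu> unit_borel (\<lambda>x. 1 - x)"

definition isometric_embedding :: "'a set \<Rightarrow> ('a \<Rightarrow> 'a \<Rightarrow> real) \<Rightarrow> ('a \<Rightarrow> 'a) \<Rightarrow> bool" where
  "isometric_embedding M d \<phi> \<longleftrightarrow>
    \<phi> \<in> M \<rightarrow> M \<and> (\<forall>x\<in>M. \<forall>y\<in>M. d (\<phi> x) (\<phi> y) = d x y)"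

(* As in BijGroup, a self-map of M is represented by a function that is undefined outside M,
   so that maps agreeing on M are equal. *)
definition IsEmb :: "'a set \<Rightarrow> ('a \<Rightarrow> 'a \<Rightarrow> real) \<Rightarrow> ('a \<Rightarrow> 'a) monoid" where
  "IsEmb M d =
    \<lparr>carrier = {\<phi> \<in> extensional M. isometric_embedding M d \<phi>},
     monoid.mult = compose M,
     one = restrict id M\<rparr>"

definition Isom :: "'a set \<Rightarrow> ('a \<Rightarrow> 'a \<Rightarrow> real) \<Rightarrow> ('a \<Rightarrow> 'a) monoid" where
  "Isom M d =
    \<lparr>carrier = {\<phi> \<in> extensional M. isometric_embedding M d \<phi> \<and> \<phi> ` M = M},
     monoid.mult = compose M,
     one = restrict id M\<rparr>"

end

theory Submission
  imports Defs
begin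

text \<open>
  The pair of Dirac masses at 0 and 1 is the only pair at distance 1, so an isometric embedding
  fixes or swaps them; after composing with the reflection it fixes both. Since
  $x^p + (1-x)^p \le 1$ with equality only at the end points, all measures carried by
  $\{0,1\}$ are then fixed as well. Finally a measure \<open>\<nu>\<close> is determined by its
  distances to the measures on $\{0,1\}$: as a function of the mass placed at 1, the transport
  cost has an explicit Legendre transform, whose derivatives are the masses \<open>\<nu>\<close> gives
  to the intervals $[c,1]$.
\<close>

text \<open>This is why the fixed family {0,1}-carried measures must by itself separate all
  measures.

  Optimal plans are never constructed in general. The cost between a measure on {0,1} and \<nu> is
  bounded below pointwise on an arbitrary plan, and the bound is attained by an explicit map that
  sends each point to one of the two end points. The variable of the transform is the Lagrange
  multiplier of the mass placed at 1. Equal costs give equal transforms directly, without a cost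
  formula and without any convexity argument.

  The hypothesis p > 1 makes interior points visible to the metric: for p = 1 the distances of a
  measure to the two extreme Dirac masses always add up to 1.\<close>

section \<open>Probability measures on the unit interval and their couplings\<close>

lemma space_unit_borel [simp]: "space unit_borel = {0..1}"
  by (simp add: unit_borel_def space_restrict_space)

lemma measurable_unit_borel_id [measurable]: "(\<lambda>x. x) \<in> unit_borel \<rightarrow>\<^sub>M borel"
  unfolding unit_borel_def by (intro measurable_restrict_space1) simp

lemma measurable_unit_borelI:
  assumes "f \<in> M \<rightarrow>\<^sub>M borel" "\<And>x. x \<in> space M \<Longrightarrow> f x \<in> {0..1}"
  shows "f \<in> M \<rightarrow>\<^sub>M unit_borel"
  unfolding unit_borel_def using assms by (intro measurable_restrict_space2) auto

lemma wspaceD: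
  assumes "\<mu> \<in> wspace"
  shows "prob_space \<mu>" "sets \<mu> = sets unit_borel" "space \<mu> = {0..1}"
  using assms sets_eq_imp_space_eq[of \<mu> unit_borel] by (auto simp: wspace_def)

lemma wspace_measurable:
  assumes "\<mu> \<in> wspace"
  shows "measurable \<mu> N = measurable unit_borel N"
  using wspaceD(2)[OF assms] by (rule measurable_cong_sets) simp

lemma wspace_integrable:
  fixes f :: "real \<Rightarrow> real"
  assumes "\<mu> \<in> wspace" "f \<in> borel_measurable unit_borel" "\<And>x. x \<in> {0..1} \<Longrightarrow> \<bar>f x\<bar> \<le> B"
  shows "integrable \<mu> f"
proof -
  interpret prob_space \<mu> using wspaceD(1)[OF assms(1)] .
  show ?thesis
    using assms by (intro integrable_const_bound[of _ B])
      (auto simp: wspace_measurable wspaceD intro!: AE_I2)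
qed

lemma distr_in_wspace:
  assumes "prob_space M" "f \<in> M \<rightarrow>\<^sub>M unit_borel"
  shows "distr M unit_borel f \<in> wspace"
  using prob_space.prob_space_distr[OF assms] by (simp add: wspace_def)

lemma return_in_wspace: "c \<in> {0..1} \<Longrightarrow> return unit_borel c \<in> wspace"
  by (simp add: wspace_def prob_space_return)

lemma wspace_eqI:
  assumes "\<mu> \<in> wspace" "\<nu> \<in> wspace" "\<And>A. A \<in> sets unit_borel \<Longrightarrow> measure \<mu> A = measure \<nu> A"
  shows "\<mu> = \<nu>"
proof (rule measure_eqI)
  interpret \<mu>: prob_space \<mu> using wspaceD(1)[OF assms(1)] .
  interpret \<nu>: prob_space \<nu> using wspaceD(1)[OF assms(2)] .
  show "sets \<mu> = sets \<nu>" using wspaceD(2)[OF assms(1)] wspaceD(2)[OF assms(2)] by simp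
  show "emeasure \<mu> A = emeasure \<nu> A" if "A \<in> sets \<mu>" for A
    using that assms(3)[of A] wspaceD(2)[OF assms(1)]
    by (simp add: \<mu>.emeasure_eq_measure \<nu>.emeasure_eq_measure)
qed

lemma couplingsD:
  assumes "\<pi> \<in> couplings \<mu> \<nu>"
  shows "prob_space \<pi>" "sets \<pi> = sets (unit_borel \<Otimes>\<^sub>M unit_borel)" "space \<pi> = {0..1} \<times> {0..1}"
    "\<And>N. measurable \<pi> N = measurable (unit_borel \<Otimes>\<^sub>M unit_borel) N"
    "distr \<pi> unit_borel fst = \<mu>" "distr \<pi> unit_borel snd = \<nu>"
    "fst \<in> \<pi> \<rightarrow>\<^sub>M unit_borel" "snd \<in> \<pi> \<rightarrow>\<^sub>M unit_borel"
proof -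
  show *: "prob_space \<pi>" "sets \<pi> = sets (unit_borel \<Otimes>\<^sub>M unit_borel)"
    "distr \<pi> unit_borel fst = \<mu>" "distr \<pi> unit_borel snd = \<nu>"
    using assms by (auto simp: couplings_def)
  show "space \<pi> = {0..1} \<times> {0..1}"
    using sets_eq_imp_space_eq[OF *(2)] by (simp add: space_pair_measure)
  show **: "measurable \<pi> N = measurable (unit_borel \<Otimes>\<^sub>M unit_borel) N" for N
    using *(2) by (rule measurable_cong_sets) simp
  show "fst \<in> \<pi> \<rightarrow>\<^sub>M unit_borel" "snd \<in> \<pi> \<rightarrow>\<^sub>M unit_borel"
    unfolding ** by simp_all
qed

lemma measurable_pair_unit_borel [measurable]:
  "fst \<in> unit_borel \<Otimes>\<^sub>M unit_borel \<rightarrow>\<^sub>M (borel :: real measure)"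
  "snd \<in> unit_borel \<Otimes>\<^sub>M unit_borel \<rightarrow>\<^sub>M (borel :: real measure)"
  using measurable_compose[OF measurable_fst measurable_unit_borel_id]
        measurable_compose[OF measurable_snd measurable_unit_borel_id] by auto

lemma couplings_integrable:
  fixes f :: "real \<times> real \<Rightarrow> real"
  assumes "\<pi> \<in> couplings \<mu> \<nu>" "f \<in> borel_measurable (unit_borel \<Otimes>\<^sub>M unit_borel)"
    "\<And>x y. x \<in> {0..1} \<Longrightarrow> y \<in> {0..1} \<Longrightarrow> \<bar>f (x, y)\<bar> \<le> B"
  shows "integrable \<pi> f"
proof -
  interpret prob_space \<pi> using couplingsD(1)[OF assms(1)] .
  show ?thesis
    using assms(2,3) couplingsD(3)[OF assms(1)]
    by (intro integrable_const_bound[of _ B])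
      (auto simp: couplingsD(4)[OF assms(1)] intro!: AE_I2)
qed

lemma couplings_integral_snd:
  fixes f :: "real \<Rightarrow> real"
  assumes "\<pi> \<in> couplings \<mu> \<nu>" "f \<in> borel_measurable unit_borel"
  shows "(\<integral>z. f (snd z) \<partial>\<pi>) = (\<integral>y. f y \<partial>\<nu>)"
  using integral_distr[OF couplingsD(8)[OF assms(1)] assms(2)] couplingsD(6)[OF assms(1)] by simp

lemma couplings_integral_fst:
  fixes f :: "real \<Rightarrow> real"
  assumes "\<pi> \<in> couplings \<mu> \<nu>" "f \<in> borel_measurable unit_borel"
  shows "(\<integral>z. f (fst z) \<partial>\<pi>) = (\<integral>y. f y \<partial>\<mu>)"
  using integral_distr[OF couplingsD(7)[OF assms(1)] assms(2)] couplingsD(5)[OF assms(1)] by simp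

lemma couplings_AE_fst:
  assumes "\<pi> \<in> couplings \<mu> \<nu>" "AE x in \<mu>. P x"
  shows "AE z in \<pi>. P (fst z)"
  using AE_distrD[OF couplingsD(7)[OF assms(1)]] assms(2) couplingsD(5)[OF assms(1)] by blast

text \<open>Guarantees that the infimum over couplings is over a nonempty set; the product also
  serves as the test plan in \<open>wcost_eq_1\<close>.\<close>

lemma pair_measure_couplings:
  assumes "\<mu> \<in> wspace" "\<nu> \<in> wspace"
  shows "\<mu> \<Otimes>\<^sub>M \<nu> \<in> couplings \<mu> \<nu>"
proof -
  interpret \<mu>: prob_space \<mu> using wspaceD(1)[OF assms(1)] .
  interpret \<nu>: prob_space \<nu> using wspaceD(1)[OF assms(2)] .
  interpret pair_prob_space \<mu> \<nu> ..
  have s: "sets (\<mu> \<Otimes>\<^sub>M \<nu>) = sets (unit_borel \<Otimes>\<^sub>M unit_borel)"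
    by (intro sets_pair_measure_cong wspaceD(2) assms)
  have "distr (\<mu> \<Otimes>\<^sub>M \<nu>) unit_borel fst = distr (\<mu> \<Otimes>\<^sub>M \<nu>) \<mu> fst"
    using wspaceD(2)[OF assms(1)] by (intro distr_cong) auto
  moreover have "distr (\<mu> \<Otimes>\<^sub>M \<nu>) \<mu> fst = \<mu>"
    by (simp add: \<nu>.distr_pair_fst \<nu>.emeasure_space_1)
  moreover have "distr (\<mu> \<Otimes>\<^sub>M \<nu>) unit_borel snd = \<nu>"
  proof (rule measure_eqI)
    show "sets (distr (\<mu> \<Otimes>\<^sub>M \<nu>) unit_borel snd) = sets \<nu>" using wspaceD(2)[OF assms(2)] by simp
    fix A assume "A \<in> sets (distr (\<mu> \<Otimes>\<^sub>M \<nu>) unit_borel snd)"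
    then have A: "A \<in> sets \<nu>" using wspaceD(2)[OF assms(2)] by simp
    then have "snd -` A \<inter> space (\<mu> \<Otimes>\<^sub>M \<nu>) = space \<mu> \<times> A"
      using sets.sets_into_space[OF A] by (auto simp: space_pair_measure)
    moreover have "snd \<in> \<mu> \<Otimes>\<^sub>M \<nu> \<rightarrow>\<^sub>M unit_borel"
      using measurable_snd[of \<mu> \<nu>]
      unfolding measurable_cong_sets[OF refl wspaceD(2)[OF assms(2)]] .
    ultimately show "emeasure (distr (\<mu> \<Otimes>\<^sub>M \<nu>) unit_borel snd) A = emeasure \<nu> A"
      using A wspaceD(2)[OF assms(2)]
      by (simp add: emeasure_distr \<nu>.emeasure_pair_measure_Times \<mu>.emeasure_space_1)
  qed
  ultimately show ?thesis
    using s prob_space_axioms by (simp add: couplings_def)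
qed

text \<open>The plan induced by a transport map out of \<nu>, written with the target in the first
  coordinate. It yields upper bounds for the cost.\<close>

lemma graph_couplings:
  assumes "\<nu> \<in> wspace" "f \<in> unit_borel \<rightarrow>\<^sub>M unit_borel"
  shows "distr \<nu> (unit_borel \<Otimes>\<^sub>M unit_borel) (\<lambda>y. (f y, y)) \<in> couplings (distr \<nu> unit_borel f) \<nu>"
proof -
  have [measurable]: "f \<in> \<nu> \<rightarrow>\<^sub>M unit_borel" "(\<lambda>y. y) \<in> \<nu> \<rightarrow>\<^sub>M unit_borel"
    using assms by (simp_all add: wspace_measurable)
  have m: "(\<lambda>y. (f y, y)) \<in> \<nu> \<rightarrow>\<^sub>M unit_borel \<Otimes>\<^sub>M unit_borel" by measurable
  have "distr \<nu> unit_borel (\<lambda>y. y) = \<nu>"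
    using wspaceD(2)[OF assms(1)] by (intro distr_id2) simp
  then show ?thesis
    using prob_space.prob_space_distr[OF wspaceD(1)[OF assms(1)] m] m
    by (simp add: couplings_def distr_distr comp_def)
qed

section \<open>The transport cost\<close>

text \<open>The p-th power of \<open>wdist\<close>. Unlike the distance it is an infimum of
  integrals, linear in the plan, so the argument runs on costs and returns to distances only through
  \<open>wdist_eq_iff\<close>.\<close>

definition wcost :: "real \<Rightarrow> real measure \<Rightarrow> real measure \<Rightarrow> real" where
  "wcost p \<mu> \<nu> = (INF \<pi>\<in>couplings \<mu> \<nu>. \<integral>(x, y). \<bar>x - y\<bar> powr p \<partial>\<pi>)"

lemma transport_cost_nonneg:
  fixes p :: real
  shows "0 \<le> (\<integral>(x, y). \<bar>x - y\<bar> powr p \<partial>\<pi>)"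
  by (rule Bochner_Integration.integral_nonneg) auto

lemma wcost_le:
  "\<pi> \<in> couplings \<mu> \<nu> \<Longrightarrow> wcost p \<mu> \<nu> \<le> (\<integral>(x, y). \<bar>x - y\<bar> powr p \<partial>\<pi>)"
  unfolding wcost_def
  by (rule cINF_lower) (auto intro!: bdd_belowI2[of _ 0] transport_cost_nonneg)

lemma wcost_greatest:
  assumes "\<mu> \<in> wspace" "\<nu> \<in> wspace"
    "\<And>\<pi>. \<pi> \<in> couplings \<mu> \<nu> \<Longrightarrow> b \<le> (\<integral>(x, y). \<bar>x - y\<bar> powr p \<partial>\<pi>)"
  shows "b \<le> wcost p \<mu> \<nu>"
  unfolding wcost_def using assms pair_measure_couplings by (intro cINF_greatest) auto

lemma wdist_eq_iff:
  assumes "p > 0" "\<mu> \<in> wspace" "\<nu> \<in> wspace" "\<mu>' \<in> wspace" "\<nu>' \<in> wspace"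
  shows "wdist p \<mu> \<nu> = wdist p \<mu>' \<nu>' \<longleftrightarrow> wcost p \<mu> \<nu> = wcost p \<mu>' \<nu>'"
proof -
  \<comment> \<open>Undoing the root requires a nonnegative cost. For a real infimum this rests on
    the set of couplings being nonempty, which is built into \<open>wcost_greatest\<close>.\<close>
  have "(wdist p \<mu> \<nu>) powr p = wcost p \<mu> \<nu>" if "\<mu> \<in> wspace" "\<nu> \<in> wspace" for \<mu> \<nu>
    using wcost_greatest[OF that transport_cost_nonneg] assms(1)
    by (simp add: wdist_def wcost_def[symmetric] powr_powr)
  then show ?thesis using assms by (metis wdist_def wcost_def)
qed

lemma cost_integrand_bound:
  fixes x y p :: real
  assumes "p > 0" "x \<in> {0..1}" "y \<in> {0..1}"
  shows "\<bar>x - y\<bar> powr p \<le> 1"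
  using assms by (intro powr_le1) auto

lemma cost_integrand_measurable [measurable]:
  "(\<lambda>(x, y). \<bar>x - y\<bar> powr p) \<in> borel_measurable (unit_borel \<Otimes>\<^sub>M unit_borel)"
  by (simp add: case_prod_beta') measurable

lemma cost_integrable:
  assumes "p > 0" "\<pi> \<in> couplings \<mu> \<nu>"
  shows "integrable \<pi> (\<lambda>(x, y). \<bar>x - y\<bar> powr p)"
  using assms cost_integrand_bound
  by (intro couplings_integrable[OF assms(2), of _ 1] cost_integrand_measurable) auto

section \<open>Dirac masses and pairs at distance 1\<close>

lemma AE_return_unit_borel: "c \<in> {0..1} \<Longrightarrow> AE x in return unit_borel c. x = c"
proof -
  assume c: "c \<in> {0..1}"
  have "Measurable.pred unit_borel (\<lambda>x. x = c)" by measurable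
  then show ?thesis using c by (subst AE_return) auto
qed

text \<open>Under any coupling the first coordinate equals \<open>c\<close> almost surely, so all
  couplings cost the same and the infimum is over a single value.\<close>

lemma wcost_return:
  assumes "p > 0" "\<nu> \<in> wspace" "c \<in> {0..1}"
  shows "wcost p (return unit_borel c) \<nu> = (\<integral>y. \<bar>c - y\<bar> powr p \<partial>\<nu>)"
proof -
  have "(\<integral>(x, y). \<bar>x - y\<bar> powr p \<partial>\<pi>) = (\<integral>y. \<bar>c - y\<bar> powr p \<partial>\<nu>)"
    if \<pi>: "\<pi> \<in> couplings (return unit_borel c) \<nu>" for \<pi>
  proof -
    have "(\<integral>(x, y). \<bar>x - y\<bar> powr p \<partial>\<pi>) = (\<integral>z. \<bar>c - snd z\<bar> powr p \<partial>\<pi>)"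
    proof (rule integral_cong_AE)
      show "AE z in \<pi>. (case z of (x, y) \<Rightarrow> \<bar>x - y\<bar> powr p) = \<bar>c - snd z\<bar> powr p"
        using couplings_AE_fst[OF \<pi> AE_return_unit_borel[OF assms(3)]]
        by eventually_elim auto
    qed (simp_all add: couplingsD(4)[OF \<pi>])
    also have "\<dots> = (\<integral>y. \<bar>c - y\<bar> powr p \<partial>\<nu>)"
      by (rule couplings_integral_snd[OF \<pi>]) measurable
    finally show ?thesis .
  qed
  then have "(\<lambda>\<pi>. \<integral>(x, y). \<bar>x - y\<bar> powr p \<partial>\<pi>) ` couplings (return unit_borel c) \<nu> =
      {\<integral>y. \<bar>c - y\<bar> powr p \<partial>\<nu>}"
    using pair_measure_couplings[OF return_in_wspace[OF assms(3)] assms(2)]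
    by (auto simp: image_iff)
  then show ?thesis by (simp add: wcost_def)
qed

lemma wcost_return_0:
  assumes "p > 0" "\<nu> \<in> wspace"
  shows "wcost p (return unit_borel 0) \<nu> = (\<integral>y. y powr p \<partial>\<nu>)"
  unfolding wcost_return[OF assms, of 0, simplified]
  by (rule Bochner_Integration.integral_cong) (auto simp: wspaceD(3)[OF assms(2)])

lemma wcost_return_1:
  assumes "p > 0" "\<nu> \<in> wspace"
  shows "wcost p (return unit_borel 1) \<nu> = (\<integral>y. (1 - y) powr p \<partial>\<nu>)"
  unfolding wcost_return[OF assms, of 1, simplified]
  by (rule Bochner_Integration.integral_cong) (auto simp: wspaceD(3)[OF assms(2)])

lemma eq_return:
  assumes "\<mu> \<in> wspace" "c \<in> {0..1}" "AE x in \<mu>. x = c"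
  shows "\<mu> = return unit_borel c"
proof (rule measure_eqI)
  show "sets \<mu> = sets (return unit_borel c)" using wspaceD(2)[OF assms(1)] by simp
  interpret prob_space \<mu> using wspaceD(1)[OF assms(1)] .
  fix A assume A: "A \<in> sets \<mu>"
  have "emeasure \<mu> A = (\<integral>\<^sup>+x. indicator A x \<partial>\<mu>)" using A by simp
  also have "\<dots> = (\<integral>\<^sup>+x. indicator A c \<partial>\<mu>)"
    using assms(3) by (intro nn_integral_cong_AE) auto
  also have "\<dots> = emeasure (return unit_borel c) A"
    using A wspaceD(2)[OF assms(1)] by (simp add: emeasure_space_1)
  finally show "emeasure \<mu> A = emeasure (return unit_borel c) A" .
qed

text \<open>Needed at the end to tell the reflection from the identity.\<close>

lemma return_0_neq_1: "return unit_borel 0 \<noteq> return unit_borel 1"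
proof
  assume eq: "return unit_borel 0 = return unit_borel (1::real)"
  have "AE x in return unit_borel (1::real). x = 0" "AE x in return unit_borel (1::real). x = 1"
    using AE_return_unit_borel[of 0, unfolded eq] AE_return_unit_borel[of 1] by simp_all
  then have "AE x in return unit_borel (1::real). False" by eventually_elim simp
  then show False
    using prob_space.AE_False prob_space_return[of 1 unit_borel] by auto
qed

lemma wcost_return_0_1: "p > 0 \<Longrightarrow> wcost p (return unit_borel 0) (return unit_borel 1) = 1"
  by (simp add: wcost_return_0 return_in_wspace) (subst integral_return; simp)

lemma AE_prob_space_ex:
  assumes "prob_space M" "AE x in M. P x"
  shows "\<exists>x. P x"
proof (rule ccontr)
  assume "\<nexists>x. P x"
  then have "P = (\<lambda>_. False)" by (simp add: fun_eq_iff)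
  then show False using assms prob_space.AE_False[OF assms(1)] by simp
qed

text \<open>Pairs other than the Dirac masses at the end points have distance less than 1,
  because already their product coupling costs less than 1.\<close>

lemma wcost_eq_1:
  assumes "p > 0" "\<mu> \<in> wspace" "\<nu> \<in> wspace" "wcost p \<mu> \<nu> = 1"
  shows "(\<mu> = return unit_borel 0 \<and> \<nu> = return unit_borel 1) \<or>
         (\<mu> = return unit_borel 1 \<and> \<nu> = return unit_borel 0)"
proof -
  interpret \<mu>: prob_space \<mu> using wspaceD(1)[OF assms(2)] .
  interpret \<nu>: prob_space \<nu> using wspaceD(1)[OF assms(3)] .
  interpret pair_prob_space \<mu> \<nu> ..
  let ?f = "\<lambda>(x, y). \<bar>x - y\<bar> powr p :: real"
  have \<pi>: "\<mu> \<Otimes>\<^sub>M \<nu> \<in> couplings \<mu> \<nu>" by (rule pair_measure_couplings[OF assms(2,3)])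
  have int: "integrable (\<mu> \<Otimes>\<^sub>M \<nu>) ?f" by (rule cost_integrable[OF assms(1) \<pi>])
  have le1: "AE z in \<mu> \<Otimes>\<^sub>M \<nu>. 0 \<le> 1 - ?f z"
    using couplingsD(3)[OF \<pi>] cost_integrand_bound[OF assms(1)] by (intro AE_I2) auto
  have int1: "(\<integral>z. 1 - ?f z \<partial>(\<mu> \<Otimes>\<^sub>M \<nu>)) = 1 - (\<integral>z. ?f z \<partial>(\<mu> \<Otimes>\<^sub>M \<nu>))"
    using int by (simp add: prob_space)
  have "(\<integral>z. 1 - ?f z \<partial>(\<mu> \<Otimes>\<^sub>M \<nu>)) = 0"
    using wcost_le[OF \<pi>, of p] assms(4) int1 integral_nonneg_AE[OF le1] by linarith
  moreover have "integrable (\<mu> \<Otimes>\<^sub>M \<nu>) (\<lambda>z. 1 - ?f z)" using int by simp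
  ultimately have "AE z in \<mu> \<Otimes>\<^sub>M \<nu>. 1 - ?f z = 0"
    using integral_nonneg_eq_0_iff_AE[OF _ le1] by blast
  then have "AE z in \<mu> \<Otimes>\<^sub>M \<nu>. (fst z = 0 \<and> snd z = 1) \<or> (fst z = 1 \<and> snd z = 0)"
  proof (rule AE_mp, intro AE_I2 impI)
    fix z assume z: "z \<in> space (\<mu> \<Otimes>\<^sub>M \<nu>)" "1 - ?f z = 0"
    obtain x y where [simp]: "z = (x, y)" by fastforce
    have *: "x \<in> {0..1}" "y \<in> {0..1}"
      using z(1) unfolding couplingsD(3)[OF \<pi>] by simp_all
    have "\<bar>x - y\<bar> powr p = 1" using z(2) by simp
    then have "\<not> \<bar>x - y\<bar> < 1"
      using powr_less_mono2[OF assms(1), of "\<bar>x - y\<bar>" 1]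
      by (metis abs_ge_zero less_irrefl powr_one_eq_one)
    then have "(x = 0 \<and> y = 1) \<or> (x = 1 \<and> y = 0)" using * by (simp add: abs_if split: if_splits)
    then show "(fst z = 0 \<and> snd z = 1) \<or> (fst z = 1 \<and> snd z = 0)" by simp
  qed
  \<comment> \<open>The product structure matters here: another plan of cost 1 could mix (0,1) with
    (1,0), as when two equal measures swap half of their mass. For the product, Fubini gives a
    condition on all but a null set of y for one and the same x.\<close>
  then have ae: "AE x in \<mu>. AE y in \<nu>. (x = 0 \<and> y = 1) \<or> (x = 1 \<and> y = 0)"
    by (rule AE_pair[where Q = "\<lambda>z. (fst z = 0 \<and> snd z = 1) \<or> (fst z = 1 \<and> snd z = 0)", unfolded fst_conv snd_conv])
  \<comment> \<open>A single typical x already pins \<nu> to the point 1 - x, and \<nu> in turn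
    forces almost every other x' to equal x.\<close>
  obtain x :: real where x: "AE y in \<nu>. (x = 0 \<and> y = 1) \<or> (x = 1 \<and> y = 0)"
    using AE_prob_space_ex[OF \<mu>.prob_space_axioms ae] by (rule exE)
  have x01: "x = 0 \<or> x = 1"
  proof (rule ccontr)
    assume "\<not> (x = 0 \<or> x = 1)"
    then show False using x \<nu>.AE_False by simp
  qed
  have \<nu>: "AE y in \<nu>. y = 1 - x" using x by eventually_elim (elim disjE conjE; linarith)
  have \<mu>: "AE x' in \<mu>. x' = x"
    using ae
  proof eventually_elim
    case (elim x')
    then have "AE y in \<nu>. x' = x" using \<nu> by eventually_elim (elim disjE conjE; linarith)
    then show ?case by simp
  qed
  show ?thesis
    using x01 eq_return[OF assms(2) _ \<mu>] eq_return[OF assms(3) _ \<nu>] by auto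
qed

section \<open>Measures carried by the end points\<close>

lemma powr_le_self:
  fixes x p :: real
  assumes "p > 1" "x \<in> {0..1}"
  shows "x powr p \<le> x"
  using powr_mono'[of 1 p x] assms by simp

lemma powr_less_self:
  fixes x p :: real
  assumes "p > 1" "x \<in> {0<..<1}"
  shows "x powr p < x"
  using powr_less_mono'[of x 1 p] assms by simp

lemma wspace_integrable_powr:
  assumes "p > 0" "\<mu> \<in> wspace"
  shows "integrable \<mu> (\<lambda>x. x powr p)" "integrable \<mu> (\<lambda>x. (1 - x) powr p)"
  using assms by (auto intro!: wspace_integrable[of _ _ 1] powr_le1)

text \<open>The right-hand side mentions only costs to the two extreme Dirac masses, so an embedding
  that fixes both preserves the property on the left. The deficit 1 - (x^p + (1-x)^p) is
  nonnegative, hence its integral vanishes only if it vanishes almost everywhere.\<close>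

lemma AE_endpoints_iff:
  assumes "p > 1" "\<mu> \<in> wspace"
  shows "(AE x in \<mu>. x = 0 \<or> x = 1) \<longleftrightarrow>
    wcost p (return unit_borel 0) \<mu> + wcost p (return unit_borel 1) \<mu> = 1"
proof -
  interpret prob_space \<mu> using wspaceD(1)[OF assms(2)] .
  have p: "p > 0" using assms by simp
  let ?f = "\<lambda>x. 1 - (x powr p + (1 - x) powr p)"
  have int: "integrable \<mu> ?f"
    using wspace_integrable_powr[OF p assms(2)] by simp
  have nonneg: "AE x in \<mu>. 0 \<le> ?f x"
  proof (rule AE_I2)
    fix x assume "x \<in> space \<mu>"
    then have "x \<in> {0..1}" using wspaceD(3)[OF assms(2)] by simp
    then show "0 \<le> ?f x"
      using powr_le_self[OF assms(1), of x] powr_le_self[OF assms(1), of "1 - x"] by auto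
  qed
  have eq: "?f x = 0 \<longleftrightarrow> x = 0 \<or> x = 1" if "x \<in> {0..1}" for x
    using that powr_less_self[OF assms(1), of x] powr_less_self[OF assms(1), of "1 - x"] p
    by (cases "x = 0 \<or> x = 1") auto
  have "wcost p (return unit_borel 0) \<mu> + wcost p (return unit_borel 1) \<mu> = 1
      \<longleftrightarrow> (\<integral>x. ?f x \<partial>\<mu>) = 0"
    using wspace_integrable_powr[OF p assms(2)]
    by (simp add: wcost_return_0[OF p assms(2)] wcost_return_1[OF p assms(2)] prob_space)
  also have "\<dots> \<longleftrightarrow> (AE x in \<mu>. ?f x = 0)"
    by (rule integral_nonneg_eq_0_iff_AE[OF int nonneg])
  also have "\<dots> \<longleftrightarrow> (AE x in \<mu>. x = 0 \<or> x = 1)"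
    using eq wspaceD(3)[OF assms(2)] by (intro AE_cong) auto
  finally show ?thesis by simp
qed

text \<open>On {0,1} every function is affine in x^p, in particular every indicator, so a single
  integral determines the measure. The p-th power is chosen over x because its integral is the cost
  to the Dirac mass at 0.\<close>

lemma endpoints_eqI:
  assumes "p > 0" "\<mu> \<in> wspace" "\<nu> \<in> wspace"
    "AE x in \<mu>. x = 0 \<or> x = 1" "AE x in \<nu>. x = 0 \<or> x = 1"
    "(\<integral>x. x powr p \<partial>\<mu>) = (\<integral>x. x powr p \<partial>\<nu>)"
  shows "\<mu> = \<nu>"
proof (rule wspace_eqI[OF assms(2,3)])
  fix A assume A: "A \<in> sets unit_borel"
  have "measure \<mu> A = indicator A 0 + (indicator A 1 - indicator A 0) * (\<integral>x. x powr p \<partial>\<mu>)"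
    if \<mu>: "\<mu> \<in> wspace" "AE x in \<mu>. x = 0 \<or> x = 1" for \<mu>
  proof -
    interpret prob_space \<mu> using wspaceD(1)[OF \<mu>(1)] .
    have [measurable]: "A \<in> sets \<mu>" using A wspaceD(2)[OF \<mu>(1)] by simp
    have [measurable]: "(\<lambda>x. x powr p) \<in> borel_measurable \<mu>"
      by (simp add: wspace_measurable[OF \<mu>(1)])
    have "measure \<mu> A = (\<integral>x. indicator A x \<partial>\<mu>)" by simp
    also have "\<dots> = (\<integral>x. indicator A 0 + (indicator A 1 - indicator A 0) * x powr p \<partial>\<mu>)"
    proof (rule integral_cong_AE)
      show "AE x in \<mu>. indicator A x =
          (indicator A 0 + (indicator A 1 - indicator A 0) * x powr p :: real)"
        using \<mu>(2) by eventually_elim (use assms(1) in auto)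
    qed measurable
    also have "\<dots> = indicator A 0 + (indicator A 1 - indicator A 0) * (\<integral>x. x powr p \<partial>\<mu>)"
      using wspace_integrable_powr(1)[OF assms(1) \<mu>(1)] by (simp add: prob_space)
    finally show ?thesis .
  qed
  then show "measure \<mu> A = measure \<nu> A" using assms by simp
qed

section \<open>Duality for transport from the end points\<close>

text \<open>Legendre transform, in the mass placed at 1, of the cost of transporting a measure on
  the end points to \<open>\<nu>\<close>.\<close>

definition truncated_cost :: "real \<Rightarrow> real \<Rightarrow> real measure \<Rightarrow> real" where
  "truncated_cost p l \<nu> = (\<integral>y. min (y powr p) ((1 - y) powr p - l) \<partial>\<nu>)"

lemma truncated_cost_integrand_bound:
  fixes p l y :: real
  assumes "p > 0" "y \<in> {0..1}"
  shows "\<bar>min (y powr p) ((1 - y) powr p - l)\<bar> \<le> 1 + \<bar>l\<bar>"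
proof -
  have "y powr p \<le> 1" "(1 - y) powr p \<le> 1" "y powr p \<ge> 0" "(1 - y) powr p \<ge> 0"
    using assms by (auto intro!: powr_le1)
  then show ?thesis by linarith
qed

lemma truncated_cost_integrand_measurable [measurable]:
  "(\<lambda>y. min (y powr p) ((1 - y) powr p - l)) \<in> borel_measurable unit_borel"
  by measurable

lemma truncated_cost_integrable:
  assumes "p > 0" "\<nu> \<in> wspace"
  shows "integrable \<nu> (\<lambda>y. min (y powr p) ((1 - y) powr p - l))"
  by (rule wspace_integrable[OF assms(2) truncated_cost_integrand_measurable])
    (rule truncated_cost_integrand_bound[OF assms(1)])

text \<open>Weak duality. The inequality holds pointwise on any plan: for x = 0 use the first branch
  of the minimum, for x = 1 the second, where \<open>l * x\<close> cancels \<open>- l\<close>. The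
  integral of x is the mass of \<mu> at 1.\<close>

lemma truncated_cost_le:
  assumes "p > 0" "\<mu> \<in> wspace" "\<nu> \<in> wspace" "AE x in \<mu>. x = 0 \<or> x = 1"
  shows "truncated_cost p l \<nu> + l * (\<integral>x. x \<partial>\<mu>) \<le> wcost p \<mu> \<nu>"
proof (rule wcost_greatest[OF assms(2,3)])
  fix \<pi> assume \<pi>: "\<pi> \<in> couplings \<mu> \<nu>"
  interpret prob_space \<pi> using couplingsD(1)[OF \<pi>] .
  let ?m = "\<lambda>y. min (y powr p) ((1 - y) powr p - l)"
  have m: "?m \<in> borel_measurable unit_borel" by measurable
  have i1: "integrable \<pi> (\<lambda>z. ?m (snd z))"
  proof (rule couplings_integrable[OF \<pi>, of _ "1 + \<bar>l\<bar>"])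
    show "(\<lambda>z. ?m (snd z)) \<in> borel_measurable (unit_borel \<Otimes>\<^sub>M unit_borel)" by measurable
    show "\<bar>?m (snd (x, y))\<bar> \<le> 1 + \<bar>l\<bar>" if "y \<in> {0..1}" for x y
      using truncated_cost_integrand_bound[OF assms(1) that] by simp
  qed
  have i2: "integrable \<pi> (\<lambda>z. l * fst z)"
    by (rule integrable_mult_right, rule couplings_integrable[OF \<pi>, of _ 1]) auto
  have "truncated_cost p l \<nu> + l * (\<integral>x. x \<partial>\<mu>) = (\<integral>z. ?m (snd z) \<partial>\<pi>) + l * (\<integral>z. fst z \<partial>\<pi>)"
    unfolding truncated_cost_def
    using couplings_integral_snd[OF \<pi> m] couplings_integral_fst[OF \<pi> measurable_unit_borel_id]
    by simp
  also have "\<dots> = (\<integral>z. ?m (snd z) + l * fst z \<partial>\<pi>)"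
    using i1 i2 by simp
  also have "\<dots> \<le> (\<integral>(x, y). \<bar>x - y\<bar> powr p \<partial>\<pi>)"
  proof (rule integral_mono_AE)
    show "integrable \<pi> (\<lambda>z. ?m (snd z) + l * fst z)" using i1 i2 by simp
    show "integrable \<pi> (\<lambda>(x, y). \<bar>x - y\<bar> powr p)" by (rule cost_integrable[OF assms(1) \<pi>])
    have "AE z in \<pi>. z \<in> {0..1} \<times> {0..1}" by (rule AE_I2) (simp add: couplingsD(3)[OF \<pi>])
    then show "AE z in \<pi>. ?m (snd z) + l * fst z \<le> (case z of (x, y) \<Rightarrow> \<bar>x - y\<bar> powr p)"
      using couplings_AE_fst[OF \<pi> assms(4)]
    proof eventually_elim
      case (elim z)
      obtain x y where z: "z = (x, y)" by fastforce
      then have "y \<in> {0..1}" "x = 0 \<or> x = 1" using elim by simp_all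
      moreover have "?m y \<le> y powr p" "?m y \<le> (1 - y) powr p - l" by simp_all
      ultimately show ?case using z by (auto simp: abs_of_nonneg)
    qed
  qed
  finally show "truncated_cost p l \<nu> + l * (\<integral>x. x \<partial>\<mu>) \<le> (\<integral>(x, y). \<bar>x - y\<bar> powr p \<partial>\<pi>)" .
qed

text \<open>Strong duality for a fixed \<open>l\<close>: with \<open>l\<close> as a reward for
  arriving at 1, moving each y to its cheaper end point attains the minimum pointwise. The
  push-forward of \<nu> under this choice is the required measure.\<close>

lemma truncated_cost_attained:
  assumes "p > 0" "\<nu> \<in> wspace"
  obtains \<mu> where "\<mu> \<in> wspace" "AE x in \<mu>. x = 0 \<or> x = 1"
    "wcost p \<mu> \<nu> \<le> truncated_cost p l \<nu> + l * (\<integral>x. x \<partial>\<mu>)"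
proof
  let ?m = "\<lambda>y. min (y powr p) ((1 - y) powr p - l)"
  \<comment> \<open>\<open>f\<close> records which branch of the minimum is active. Ties go to 0,
    but the identity for the cost below holds for either choice.\<close>
  define f :: "real \<Rightarrow> real" where "f y = (if (1 - y) powr p - l < y powr p then 1 else 0)" for y
  define \<mu> where "\<mu> = distr \<nu> unit_borel f"
  define \<pi> where "\<pi> = distr \<nu> (unit_borel \<Otimes>\<^sub>M unit_borel) (\<lambda>y. (f y, y))"
  have f: "f \<in> unit_borel \<rightarrow>\<^sub>M unit_borel"
  proof (rule measurable_unit_borelI)
    show "f \<in> borel_measurable unit_borel" unfolding f_def by measurable
  qed (simp add: f_def)
  have [measurable]: "f \<in> \<nu> \<rightarrow>\<^sub>M unit_borel" using f by (simp add: wspace_measurable[OF assms(2)])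
  show \<mu>: "\<mu> \<in> wspace"
    unfolding \<mu>_def by (rule distr_in_wspace) (simp_all add: wspaceD[OF assms(2)])
  have \<pi>: "\<pi> \<in> couplings \<mu> \<nu>" unfolding \<pi>_def \<mu>_def by (rule graph_couplings[OF assms(2) f])
  show "AE x in \<mu>. x = 0 \<or> x = 1"
    unfolding \<mu>_def
  proof (subst AE_distr_iff)
    show "{x \<in> space unit_borel. x = 0 \<or> x = 1} \<in> sets unit_borel" by measurable
  qed (simp_all add: f_def)
  have meas: "(\<lambda>y. (f y, y)) \<in> \<nu> \<rightarrow>\<^sub>M unit_borel \<Otimes>\<^sub>M unit_borel"
    using f by (simp add: wspace_measurable[OF assms(2)])
  have i1: "integrable \<nu> ?m" by (rule truncated_cost_integrable[OF assms])
  have i2: "integrable \<nu> f"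
    by (rule wspace_integrable[OF assms(2), of _ 1])
      (auto simp: f_def intro: measurable_compose[OF f measurable_unit_borel_id])
  have "wcost p \<mu> \<nu> \<le> (\<integral>(x, y). \<bar>x - y\<bar> powr p \<partial>\<pi>)" by (rule wcost_le[OF \<pi>])
  also have "\<dots> = (\<integral>y. \<bar>f y - y\<bar> powr p \<partial>\<nu>)"
    unfolding \<pi>_def by (subst integral_distr[OF meas cost_integrand_measurable]) simp
  also have "\<dots> = (\<integral>y. ?m y + l * f y \<partial>\<nu>)"
  proof (rule Bochner_Integration.integral_cong)
    fix y assume "y \<in> space \<nu>"
    then have y: "y \<in> {0..1}" using wspaceD(3)[OF assms(2)] by simp
    show "\<bar>f y - y\<bar> powr p = ?m y + l * f y"
    proof (cases "(1 - y) powr p - l < y powr p")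
      case True
      then show ?thesis using y by (simp add: f_def min_absorb2)
    next
      case False
      then show ?thesis using y by (simp add: f_def min_absorb1)
    qed
  qed simp
  also have "\<dots> = truncated_cost p l \<nu> + l * (\<integral>y. f y \<partial>\<nu>)"
    using i1 i2 by (simp add: truncated_cost_def)
  also have "(\<integral>y. f y \<partial>\<nu>) = (\<integral>x. x \<partial>\<mu>)"
    unfolding \<mu>_def by (subst integral_distr) simp_all
  finally show "wcost p \<mu> \<nu> \<le> truncated_cost p l \<nu> + l * (\<integral>x. x \<partial>\<mu>)" .
qed

text \<open>The minimiser belonging to one measure is inserted into the weak inequality for the
  other; the terms \<open>l * (\<integral>x. x \<partial>\<mu>)\<close> then cancel.\<close>

lemma truncated_cost_eqI:
  assumes "p > 0" "\<nu> \<in> wspace" "\<nu>' \<in> wspace"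
    "\<And>\<mu>. \<mu> \<in> wspace \<Longrightarrow> AE x in \<mu>. x = 0 \<or> x = 1 \<Longrightarrow> wcost p \<mu> \<nu> = wcost p \<mu> \<nu>'"
  shows "truncated_cost p l \<nu> = truncated_cost p l \<nu>'"
proof (rule antisym)
  obtain \<mu> where "\<mu> \<in> wspace" "AE x in \<mu>. x = 0 \<or> x = 1"
    "wcost p \<mu> \<nu>' \<le> truncated_cost p l \<nu>' + l * (\<integral>x. x \<partial>\<mu>)"
    using truncated_cost_attained[OF assms(1,3)] .
  then show "truncated_cost p l \<nu> \<le> truncated_cost p l \<nu>'"
    using truncated_cost_le[OF assms(1) _ assms(2), of \<mu> l] assms(4)[of \<mu>] by simp
  obtain \<mu> where "\<mu> \<in> wspace" "AE x in \<mu>. x = 0 \<or> x = 1"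
    "wcost p \<mu> \<nu> \<le> truncated_cost p l \<nu> + l * (\<integral>x. x \<partial>\<mu>)"
    using truncated_cost_attained[OF assms(1,2)] .
  then show "truncated_cost p l \<nu>' \<le> truncated_cost p l \<nu>"
    using truncated_cost_le[OF assms(1) _ assms(3), of \<mu> l] assms(4)[of \<mu>] by simp
qed

text \<open>Up to sign, the right derivative of the truncated cost in \<open>l\<close> is the mass of a half-line,
  since $(1-y)^p - y^p$ is strictly decreasing in \<open>y\<close>.\<close>

lemma truncated_cost_derivative:
  assumes "p > 0" "\<nu> \<in> wspace"
  shows "(\<lambda>n. (truncated_cost p l \<nu> - truncated_cost p (l + 1 / real (Suc n)) \<nu>) * real (Suc n))
    \<longlonglongrightarrow> measure \<nu> {y \<in> {0..1}. (1 - y) powr p - y powr p \<le> l}"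
proof -
  interpret prob_space \<nu> using wspaceD(1)[OF assms(2)] .
  let ?m = "\<lambda>l y. min (y powr p) ((1 - y) powr p - l)"
  let ?A = "{y \<in> {0..1::real}. (1 - y) powr p - y powr p \<le> l}"
  let ?s = "\<lambda>n y. (?m l y - ?m (l + 1 / real (Suc n)) y) * real (Suc n)"
  have int: "integrable \<nu> (?m l)" for l by (rule truncated_cost_integrable[OF assms])
  have A: "?A \<in> sets unit_borel"
  proof -
    have "{y \<in> space unit_borel. (1 - y) powr p - y powr p \<le> l} \<in> sets unit_borel" by measurable
    then show ?thesis by simp
  qed
  have "(\<lambda>n. \<integral>y. ?s n y \<partial>\<nu>) \<longlonglongrightarrow> (\<integral>y. indicator ?A y \<partial>\<nu>)"
  \<comment> \<open>Raising \<open>l\<close> by e lowers the minimum by an amount between 0 and e,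
    so every difference quotient lies in [0,1].\<close>
  proof (rule integral_dominated_convergence[where w = "\<lambda>_. 1"])
    show "(\<lambda>y. indicator ?A y :: real) \<in> borel_measurable \<nu>"
      using A wspaceD(2)[OF assms(2)] by (intro borel_measurable_indicator) simp
    show "?s n \<in> borel_measurable \<nu>" for n
      unfolding wspace_measurable[OF assms(2)] by measurable
    show "integrable \<nu> (\<lambda>_. 1 :: real)" by simp
    show "AE y in \<nu>. norm (?s n y) \<le> 1" for n
    proof (rule AE_I2)
      fix y
      have "0 \<le> min a (b - l) - min a (b - (l + e)) \<and> min a (b - l) - min a (b - (l + e)) \<le> e"
        if "0 \<le> e" for a b e :: real
        using that by linarith
      from this[of "1 / real (Suc n)" "y powr p" "(1 - y) powr p"]
      have "0 \<le> ?m l y - ?m (l + 1 / real (Suc n)) y"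
        "?m l y - ?m (l + 1 / real (Suc n)) y \<le> 1 / real (Suc n)"
        by (simp_all del: of_nat_Suc)
      moreover have "norm (x * k) \<le> 1" if "0 \<le> x" "x \<le> 1 / k" "0 < k" for x k :: real
        using that by (simp add: field_simps)
      ultimately show "norm (?s n y) \<le> 1" by (simp del: of_nat_Suc)
    qed
    show "AE y in \<nu>. (\<lambda>n. ?s n y) \<longlonglongrightarrow> indicator ?A y"
    proof (rule AE_I2)
      fix y assume "y \<in> space \<nu>"
      then have y: "y \<in> {0..1}" using wspaceD(3)[OF assms(2)] by simp
      show "(\<lambda>n. ?s n y) \<longlonglongrightarrow> indicator ?A y"
      proof (cases "y \<in> ?A")
        case True
        have "?s n y = 1" for n
        proof -
          have "min a (b - l) - min a (b - (l + e)) = e" if "0 \<le> e" "b - a \<le> l" for a b e :: real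
            using that by linarith
          from this[of "1 / real (Suc n)" "(1 - y) powr p" "y powr p"]
          have "?m l y - ?m (l + 1 / real (Suc n)) y = 1 / real (Suc n)"
            using True by (simp del: of_nat_Suc)
          then show ?thesis by simp
        qed
        then show ?thesis using True by simp
      next
        case False
        \<comment> \<open>Off \<open>?A\<close> the first branch wins by a positive margin and
          remains active for small steps. Together with the tie case this is why the right
          derivative yields the closed condition.\<close>
        then have "0 < (1 - y) powr p - y powr p - l" using y by auto
        moreover have "(\<lambda>n. 1 / real (Suc n)) \<longlonglongrightarrow> 0"
          using LIMSEQ_inverse_real_of_nat by (simp add: inverse_eq_divide)
        ultimately have "eventually (\<lambda>n. 1 / real (Suc n) < (1 - y) powr p - y powr p - l) sequentially"
          by (rule order_tendstoD(2)[rotated])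
        then have "eventually (\<lambda>n. ?s n y = indicator ?A y) sequentially"
        proof eventually_elim
          case (elim n)
          have "min a (b - l) = a \<and> min a (b - (l + e)) = a" if "0 \<le> e" "e < b - a - l" for a b e :: real
            using that by linarith
          from this[of "1 / real (Suc n)" "(1 - y) powr p" "y powr p"] elim
          have "?m l y = y powr p" "?m (l + 1 / real (Suc n)) y = y powr p"
            by (simp_all del: of_nat_Suc)
          then show ?case using False by simp
        qed
        then show ?thesis by (rule tendsto_eventually)
      qed
    qed
  qed
  moreover have "(\<integral>y. ?s n y \<partial>\<nu>) =
      (truncated_cost p l \<nu> - truncated_cost p (l + 1 / real (Suc n)) \<nu>) * real (Suc n)" for n
    using int[of l] int[of "l + 1 / real (Suc n)"] unfolding truncated_cost_def
    by (simp add: Bochner_Integration.integral_diff del: of_nat_Suc)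
  moreover have "(\<integral>y. indicator ?A y \<partial>\<nu>) = measure \<nu> ?A"
    using A wspaceD(2)[OF assms(2)] by simp
  ultimately show ?thesis by simp
qed

section \<open>Recovering a measure from its costs\<close>

text \<open>Negation turns the intervals [c,1] into lower half-lines, so the distribution functions
  of the negated measures agree and \<open>cdf_unique\<close> applies.\<close>

lemma wspace_eqI_Ici:
  assumes "\<mu> \<in> wspace" "\<nu> \<in> wspace"
    "\<And>c. c \<in> {0..1} \<Longrightarrow> measure \<mu> {c..1} = measure \<nu> {c..1}"
  shows "\<mu> = \<nu>"
proof (rule wspace_eqI[OF assms(1,2)])
  have m: "uminus \<in> \<rho> \<rightarrow>\<^sub>M borel" if "\<rho> \<in> wspace" for \<rho>
    unfolding wspace_measurable[OF that]
    by (rule borel_measurable_uminus[OF measurable_unit_borel_id])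
  have dist: "real_distribution (distr \<rho> borel uminus)" if "\<rho> \<in> wspace" for \<rho>
    using prob_space.prob_space_distr[OF wspaceD(1)[OF that] m[OF that]]
    by (simp add: real_distribution_def real_distribution_axioms_def)
  have cdf: "cdf (distr \<rho> borel uminus) t = measure \<rho> {x \<in> {0..1}. - x \<le> t}"
    if "\<rho> \<in> wspace" for \<rho> t
  proof -
    have "uminus -` {..t} \<inter> space \<rho> = {x \<in> {0..1}. - x \<le> t}"
      unfolding wspaceD(3)[OF that] by blast
    then show ?thesis unfolding cdf_def by (subst measure_distr[OF m[OF that]]) simp_all
  qed
  have "cdf (distr \<mu> borel uminus) = cdf (distr \<nu> borel uminus)"
  proof
    fix t :: real
    consider "0 < t" | "- 1 \<le> t" "t \<le> 0" | "t < - 1" by linarith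
    then show "cdf (distr \<mu> borel uminus) t = cdf (distr \<nu> borel uminus) t"
    proof cases
      case 1
      then have "{x \<in> {0..1}. - x \<le> t} = {0..1}" by auto
      then show ?thesis using assms(3)[of 0] by (simp add: cdf assms(1,2))
    next
      case 2
      then have "{x \<in> {0..1}. - x \<le> t} = {-t..1}" by auto
      then show ?thesis using assms(3)[of "- t"] 2 by (simp add: cdf assms(1,2))
    next
      case 3
      then have e: "{x \<in> {0..1}. - x \<le> t} = {}" by auto
      show ?thesis unfolding cdf[OF assms(1)] cdf[OF assms(2)] e by simp
    qed
  qed
  then have eq: "distr \<mu> borel uminus = distr \<nu> borel uminus"
    by (rule cdf_unique[OF dist[OF assms(1)] dist[OF assms(2)]])
  fix A :: "real set" assume A: "A \<in> sets unit_borel"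
  then have A': "A \<in> sets borel" "A \<subseteq> {0..1}"
    by (auto simp: unit_borel_def sets_restrict_space_iff)
  have B: "uminus -` A \<in> sets borel"
    using measurable_sets[OF borel_measurable_uminus[OF measurable_ident_sets[OF refl]] A'(1)]
    by simp
  have "measure \<rho> A = measure (distr \<rho> borel uminus) (uminus -` A)" if "\<rho> \<in> wspace" for \<rho>
  proof -
    have "uminus -` uminus -` A \<inter> space \<rho> = A" using A' wspaceD(3)[OF that] by auto
    then show ?thesis using measure_distr[OF m[OF that] B] by simp
  qed
  then show "measure \<mu> A = measure \<nu> A" using eq assms by metis
qed

lemma wspace_eqI_wcost:
  assumes "p > 0" "\<nu> \<in> wspace" "\<nu>' \<in> wspace"
    "\<And>\<mu>. \<mu> \<in> wspace \<Longrightarrow> AE x in \<mu>. x = 0 \<or> x = 1 \<Longrightarrow> wcost p \<mu> \<nu> = wcost p \<mu> \<nu>'"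
  shows "\<nu> = \<nu>'"
proof (rule wspace_eqI_Ici[OF assms(2,3)])
  fix c :: real assume c: "c \<in> {0..1}"
  \<comment> \<open>The value at \<open>c\<close> of the strictly decreasing function (1-y)^p - y^p,
    whose sublevel set at this height is therefore [c,1].\<close>
  define l where "l = (1 - c) powr p - c powr p"
  have eq: "truncated_cost p l \<nu> = truncated_cost p l \<nu>'" for l
    by (rule truncated_cost_eqI) fact+
  have "measure \<nu> {y \<in> {0..1}. (1 - y) powr p - y powr p \<le> l} =
      measure \<nu>' {y \<in> {0..1}. (1 - y) powr p - y powr p \<le> l}"
    using truncated_cost_derivative[OF assms(1,2), of l] truncated_cost_derivative[OF assms(1,3), of l]
    unfolding eq by (rule LIMSEQ_unique)
  moreover have "{y \<in> {0..1}. (1 - y) powr p - y powr p \<le> l} = {c..1}"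
  proof (intro equalityI subsetI)
    fix y assume y: "y \<in> {y \<in> {0..1}. (1 - y) powr p - y powr p \<le> l}"
    show "y \<in> {c..1}"
    proof (rule ccontr)
      assume "y \<notin> {c..1}"
      then have "(1 - c) powr p < (1 - y) powr p" "y powr p < c powr p"
        using c y assms(1) by (auto intro!: powr_less_mono2)
      then show False using y by (auto simp: l_def)
    qed
  next
    fix y assume "y \<in> {c..1}"
    then have "(1 - y) powr p \<le> (1 - c) powr p" "c powr p \<le> y powr p"
      using c assms(1) by (auto intro!: powr_mono2)
    then show "y \<in> {y \<in> {0..1}. (1 - y) powr p - y powr p \<le> l}"
      using \<open>y \<in> {c..1}\<close> c by (auto simp: l_def)
  qed
  ultimately show "measure \<nu> {c..1} = measure \<nu>' {c..1}" by simp
qed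

section \<open>Embeddings that fix the extreme Dirac masses\<close>

lemma isometric_embedding_fixing_endpoints:
  assumes "p > 1" "isometric_embedding wspace (wdist p) \<phi>"
    "\<phi> (return unit_borel 0) = return unit_borel 0"
    "\<phi> (return unit_borel 1) = return unit_borel 1"
    "\<nu> \<in> wspace"
  shows "\<phi> \<nu> = \<nu>"
proof -
  have p: "p > 0" using assms by simp
  have \<phi>: "\<phi> \<mu> \<in> wspace" if "\<mu> \<in> wspace" for \<mu>
    using that assms(2) by (auto simp: isometric_embedding_def)
  have cost: "wcost p (\<phi> \<mu>) (\<phi> \<nu>) = wcost p \<mu> \<nu>" if "\<mu> \<in> wspace" "\<nu> \<in> wspace" for \<mu> \<nu>
    using assms(2) that wdist_eq_iff[OF p \<phi> \<phi>] by (auto simp: isometric_embedding_def)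
  have fix_endpoints: "\<phi> \<mu> = \<mu>" if \<mu>: "\<mu> \<in> wspace" "AE x in \<mu>. x = 0 \<or> x = 1" for \<mu>
  proof (rule endpoints_eqI[OF p \<phi>[OF \<mu>(1)] \<mu>(1) _ \<mu>(2)])
    have c: "wcost p (return unit_borel 0) (\<phi> \<mu>) = wcost p (return unit_borel 0) \<mu>"
      "wcost p (return unit_borel 1) (\<phi> \<mu>) = wcost p (return unit_borel 1) \<mu>"
      using cost[OF return_in_wspace \<mu>(1), of 0] cost[OF return_in_wspace \<mu>(1), of 1] assms(3,4)
      by simp_all
    show "AE x in \<phi> \<mu>. x = 0 \<or> x = 1"
      using \<mu> c by (simp add: AE_endpoints_iff[OF assms(1)] \<phi>)
    show "(\<integral>x. x powr p \<partial>\<phi> \<mu>) = (\<integral>x. x powr p \<partial>\<mu>)"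
      using c(1) \<mu> by (simp add: wcost_return_0[OF p] \<phi>)
  qed
  show ?thesis
    \<comment> \<open>For \<mu> on {0,1}, \<open>\<phi> \<mu> = \<mu>\<close> turns preservation of
      cost into equality of the costs from \<mu> to \<open>\<phi> \<nu>\<close> and to
      \<nu>.\<close>
    using cost[OF _ assms(5)] fix_endpoints
    by (intro wspace_eqI_wcost[OF p \<phi>[OF assms(5)] assms(5)]) metis
qed

section \<open>The reflection\<close>

lemma measurable_reflection [measurable]: "(\<lambda>x. 1 - x) \<in> unit_borel \<rightarrow>\<^sub>M unit_borel"
  by (rule measurable_unit_borelI) auto

lemma reflection_push_in_wspace: "\<mu> \<in> wspace \<Longrightarrow> reflection_push \<mu> \<in> wspace"
  unfolding reflection_push_def
  by (rule distr_in_wspace) (simp_all add: wspaceD wspace_measurable)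

lemma reflection_push_involution:
  assumes "\<mu> \<in> wspace"
  shows "reflection_push (reflection_push \<mu>) = \<mu>"
proof -
  have "distr \<mu> unit_borel (\<lambda>x. x) = \<mu>"
    using wspaceD(2)[OF assms] by (intro distr_id2) simp
  then show ?thesis
    by (simp add: reflection_push_def distr_distr comp_def wspace_measurable[OF assms])
qed

lemma reflection_push_return:
  "c \<in> {0..1} \<Longrightarrow> reflection_push (return unit_borel c) = return unit_borel (1 - c)"
  unfolding reflection_push_def by (rule distr_return) simp_all

text \<open>Reflecting both coordinates of a plan keeps its cost. One inequality is enough: applied
  to the reflected measures, it gives the converse by involutivity.\<close>

lemma wcost_reflection_push_le:
  assumes "\<mu> \<in> wspace" "\<nu> \<in> wspace"
  shows "wcost p (reflection_push \<mu>) (reflection_push \<nu>) \<le> wcost p \<mu> \<nu>"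
proof (rule wcost_greatest[OF assms])
  fix \<pi> assume \<pi>: "\<pi> \<in> couplings \<mu> \<nu>"
  let ?P = "unit_borel \<Otimes>\<^sub>M unit_borel"
  let ?h = "\<lambda>z. (1 - fst z, 1 - snd z)"
  have h: "?h \<in> \<pi> \<rightarrow>\<^sub>M ?P"
    unfolding couplingsD(4)[OF \<pi>]
    by (intro measurable_Pair measurable_compose[OF measurable_fst measurable_reflection]
      measurable_compose[OF measurable_snd measurable_reflection])
  have "distr \<pi> unit_borel (\<lambda>z. 1 - fst z) = reflection_push \<mu>"
    "distr \<pi> unit_borel (\<lambda>z. 1 - snd z) = reflection_push \<nu>"
    using distr_distr[OF measurable_reflection couplingsD(7)[OF \<pi>]] couplingsD(5)[OF \<pi>]
      distr_distr[OF measurable_reflection couplingsD(8)[OF \<pi>]] couplingsD(6)[OF \<pi>]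
    by (simp_all add: comp_def reflection_push_def)
  then have "distr \<pi> ?P ?h \<in> couplings (reflection_push \<mu>) (reflection_push \<nu>)"
    using prob_space.prob_space_distr[OF couplingsD(1)[OF \<pi>] h] h
    by (simp add: couplings_def distr_distr comp_def)
  then have "wcost p (reflection_push \<mu>) (reflection_push \<nu>) \<le>
      (\<integral>(x, y). \<bar>x - y\<bar> powr p \<partial>distr \<pi> ?P ?h)"
    by (rule wcost_le)
  also have "\<dots> = (\<integral>(x, y). \<bar>x - y\<bar> powr p \<partial>\<pi>)"
    by (subst integral_distr[OF h cost_integrand_measurable])
      (simp add: case_prod_beta' abs_minus_commute)
  finally show "wcost p (reflection_push \<mu>) (reflection_push \<nu>) \<le> (\<integral>(x, y). \<bar>x - y\<bar> powr p \<partial>\<pi>)" .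
qed

lemma isometric_embedding_reflection_push:
  assumes "p > 0"
  shows "isometric_embedding wspace (wdist p) reflection_push"
proof -
  have "wcost p (reflection_push \<mu>) (reflection_push \<nu>) = wcost p \<mu> \<nu>"
    if "\<mu> \<in> wspace" "\<nu> \<in> wspace" for \<mu> \<nu>
    using wcost_reflection_push_le[OF that, of p]
      wcost_reflection_push_le[OF that[THEN reflection_push_in_wspace], of p] that
    by (simp add: reflection_push_involution)
  then show ?thesis
    using assms by (auto simp: isometric_embedding_def reflection_push_in_wspace wdist_eq_iff)
qed

section \<open>Classification of embeddings and the group of order two\<close>

lemma isometric_embedding_id: "isometric_embedding M d (\<lambda>x. x)"
  by (simp add: isometric_embedding_def)

lemma isometric_embedding_comp:
  "isometric_embedding M d f \<Longrightarrow> isometric_embedding M d g \<Longrightarrow> isometric_embedding M d (\<lambda>x. g (f x))"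
  by (auto simp: isometric_embedding_def Pi_iff)

text \<open>Passes between a map and its restriction to \<open>M\<close>, the form in which maps
  occur in the carriers.\<close>

lemma isometric_embedding_cong:
  "(\<And>x. x \<in> M \<Longrightarrow> f x = g x) \<Longrightarrow> isometric_embedding M d f = isometric_embedding M d g"
  by (auto simp: isometric_embedding_def Pi_iff)

lemma isometric_embedding_wspace_cases:
  assumes "p > 1" "isometric_embedding wspace (wdist p) \<phi>"
  shows "(\<forall>\<mu>\<in>wspace. \<phi> \<mu> = \<mu>) \<or> (\<forall>\<mu>\<in>wspace. \<phi> \<mu> = reflection_push \<mu>)"
proof -
  let ?d0 = "return unit_borel (0::real)" and ?d1 = "return unit_borel (1::real)"
  have p: "p > 0" using assms by simp
  have \<phi>: "\<phi> \<mu> \<in> wspace" if "\<mu> \<in> wspace" for \<mu>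
    using that assms(2) by (auto simp: isometric_embedding_def)
  have d: "?d0 \<in> wspace" "?d1 \<in> wspace" by (simp_all add: return_in_wspace)
  have "wcost p (\<phi> ?d0) (\<phi> ?d1) = wcost p ?d0 ?d1"
    using assms(2) d wdist_eq_iff[OF p \<phi> \<phi>] by (auto simp: isometric_embedding_def)
  then have "wcost p (\<phi> ?d0) (\<phi> ?d1) = 1"
    by (simp add: wcost_return_0_1[OF p])
  then consider "\<phi> ?d0 = ?d0" "\<phi> ?d1 = ?d1" | "\<phi> ?d0 = ?d1" "\<phi> ?d1 = ?d0"
    using wcost_eq_1[OF p \<phi> \<phi>] d by blast
  then show ?thesis
  proof cases
    case 1
    then show ?thesis using isometric_embedding_fixing_endpoints[OF assms] by blast
  next
    case 2
    have "reflection_push (\<phi> \<mu>) = \<mu>" if "\<mu> \<in> wspace" for \<mu>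
      using isometric_embedding_fixing_endpoints[OF assms(1)
          isometric_embedding_comp[OF assms(2) isometric_embedding_reflection_push[OF p]]] 2 that
      by (simp add: reflection_push_return)
    \<comment> \<open>Reflecting both sides once more isolates \<open>\<phi> \<mu>\<close>.\<close>
    then show ?thesis using reflection_push_involution[OF \<phi>] by metis
  qed
qed

text \<open>The multiplication table alone gives the group axioms and the isomorphism, so nothing
  about maps enters the verification.\<close>

lemma group_two_elements:
  fixes G (structure)
  assumes "carrier G = {\<one>, a}" "a \<noteq> \<one>"
    "\<one> \<otimes> \<one> = \<one>" "\<one> \<otimes> a = a" "a \<otimes> \<one> = a" "a \<otimes> a = \<one>"
  shows "group G" "G \<cong> integer_mod_group 2"
proof -
  show "group G"
    by (rule groupI) (use assms in auto)
  let ?h = "\<lambda>x. if x = \<one> then 0 else 1 :: int"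
  have "?h \<in> hom G (integer_mod_group 2)"
    using assms by (auto simp: hom_def mult_integer_mod_group carrier_integer_mod_group)
  moreover have "bij_betw ?h (carrier G) (carrier (integer_mod_group 2))"
  proof -
    have "{0..<2} = {0, 1 :: int}" by auto
    then show ?thesis
      using assms(1,2) by (auto simp: bij_betw_def inj_on_def carrier_integer_mod_group)
  qed
  ultimately show "G \<cong> integer_mod_group 2" by (auto simp: is_iso_def iso_def)
qed

theorem theorem2p6:
  fixes p :: real
  assumes "p > 1"
  shows "(\<forall>\<phi>. isometric_embedding wspace (wdist p) \<phi> \<longrightarrow>
            (\<forall>\<mu>\<in>wspace. \<phi> \<mu> = \<mu>) \<or> (\<forall>\<mu>\<in>wspace. \<phi> \<mu> = reflection_push \<mu>)) \<and>
         (\<forall>\<phi>. isometric_embedding wspace (wdist p) \<phi> \<longrightarrow> \<phi> ` wspace = wspace) \<and>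
         IsEmb wspace (wdist p) = Isom wspace (wdist p) \<and>
         group (Isom wspace (wdist p)) \<and>
         Isom wspace (wdist p) \<cong> integer_mod_group 2"
proof -
  let ?W = "wspace" and ?d = "wdist p"
  let ?e = "restrict id ?W" and ?r = "restrict reflection_push ?W"
  have p: "p > 0" using assms by simp
  have cases: "(\<forall>\<mu>\<in>?W. \<phi> \<mu> = \<mu>) \<or> (\<forall>\<mu>\<in>?W. \<phi> \<mu> = reflection_push \<mu>)"
    if "isometric_embedding ?W ?d \<phi>" for \<phi>
    using isometric_embedding_wspace_cases[OF assms that] .
  have refl_onto: "reflection_push ` ?W = ?W"
    using reflection_push_in_wspace reflection_push_involution
    by (auto simp: image_iff) metis
  have onto: "\<phi> ` ?W = ?W" if "isometric_embedding ?W ?d \<phi>" for \<phi>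
    using cases[OF that]
  proof
    assume "\<forall>\<mu>\<in>?W. \<phi> \<mu> = \<mu>"
    then show ?thesis by (simp add: image_def)
  next
    assume "\<forall>\<mu>\<in>?W. \<phi> \<mu> = reflection_push \<mu>"
    then have "\<phi> ` ?W = reflection_push ` ?W" by (intro image_cong) simp_all
    then show ?thesis using refl_onto by simp
  qed
  have emb: "isometric_embedding ?W ?d ?e" "isometric_embedding ?W ?d ?r"
    using isometric_embedding_cong[of ?W ?e "\<lambda>x. x" ?d] isometric_embedding_id[of ?W ?d]
      isometric_embedding_cong[of ?W ?r reflection_push ?d] isometric_embedding_reflection_push[OF p]
    by simp_all
  \<comment> \<open>Being undefined outside \<open>wspace\<close> upgrades agreement on
    \<open>wspace\<close> to equality of functions, so the carrier can be listed.\<close>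
  have "\<phi> = ?e \<or> \<phi> = ?r" if "isometric_embedding ?W ?d \<phi>" "\<phi> \<in> extensional ?W" for \<phi>
    using cases[OF that(1)] extensionalityI[OF that(2), of ?e] extensionalityI[OF that(2), of ?r]
    by auto
  then have carrier: "carrier (Isom ?W ?d) = {?e, ?r}"
    using emb onto by (auto simp: Isom_def)
  have one: "one (Isom ?W ?d) = ?e" and mult: "monoid.mult (Isom ?W ?d) = compose ?W"
    by (simp_all add: Isom_def)
  \<comment> \<open>The Dirac mass at 0 separates the two maps, so the carrier does not collapse to
    one element.\<close>
  have "?r (return unit_borel 0) \<noteq> ?e (return unit_borel 0)"
    using return_0_neq_1 by (simp add: return_in_wspace reflection_push_return)
  then have neq: "?r \<noteq> ?e" by metis
  have comp: "compose ?W ?e ?e = ?e" "compose ?W ?e ?r = ?r" "compose ?W ?r ?e = ?r"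
    "compose ?W ?r ?r = ?e"
    by (auto simp: compose_def fun_eq_iff reflection_push_in_wspace reflection_push_involution)
  have "group (Isom ?W ?d)" "Isom ?W ?d \<cong> integer_mod_group 2"
    using group_two_elements[of "Isom ?W ?d" ?r] carrier neq comp unfolding one mult by auto
  moreover have "IsEmb ?W ?d = Isom ?W ?d"
    using onto by (auto simp: IsEmb_def Isom_def)
  ultimately show ?thesis using cases onto by blast
qed

end
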